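(* Let $n\ge1$, $\lambda,\mu\vdash n$ with $\lambda\trianglelefteq\mu$, and let $D$ be a non-empty set of perfect matchings of $K_{2n}$ which is a $\lambda$-factorisation of index $c_\lambda$. Then $D$ is a $\mu$-factorisation of index \[c_\mu=c_\lambda\,\frac{(2\mu_1-1)!!(2\mu_2-1)!!\cdots}{(2\lambda_1-1)!!(2\lambda_2-1)!!\cdots}.\] Hence $(2\lambda_1-1)!!(2\lambda_2-1)!!\cdots$ divides $c_\lambda(2\mu_1-1)!!(2\mu_2-1)!!\cdots$ for all $\mu\vdash n$ with $\lambda\trianglelefteq\mu$.
   Context: A perfect matching of $K_{2n}$ is a set partition of $\{1,\dots,2n\}$ into pairs. For $\lambda\vdash n$, a set partition of $\{1,\dots,2n\}$ has shape $2\lambda$ if its block sizes are $2\lambda_1,2\lambda_2,\dots$. A non-empty set $D$ of perfect matchings is a $\lambda$-factorisation of index $c$ if for every set partition $P$ of shape $2\lambda$ exactly $c$ matchings in $D$ refine $P$ (each edge lies within a block of $P$). Dominance order: $\lambda\trianglelefteq\mu$ iff $\sum_{i=1}^k\lambda_i\le\sum_{i=1}^k\mu_i$ for all $k$. Products run over the non-zero parts; $(2m-1)!!=(2m-1)(2m-3)\cdots1$, with $(-1)!!=1$. *)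

theory Defs
  imports Complex_Main "HOL-Library.Multiset" "HOL-Library.Disjoint_Sets"
begin

text \<open>A number partition of \<open>n\<close> is the list of its non-zero parts in weakly decreasing order.\<close>

definition number_partition :: "nat \<Rightarrow> nat list \<Rightarrow> bool" where
  "number_partition n lam \<longleftrightarrow>
     sorted_wrt (\<ge>) lam \<and> (\<forall>m\<in>set lam. 0 < m) \<and> sum_list lam = n"

text \<open>\<^const>\<open>take\<close> beyond the end of the list returns the whole list, which amounts to padding
  the partition with zeros.\<close>

definition dominated_by :: "nat list \<Rightarrow> nat list \<Rightarrow> bool" where
  "dominated_by lam mu \<longleftrightarrow> (\<forall>k. sum_list (take k lam) \<le> sum_list (take k mu))"

text \<open>The product below only uses odd arguments \<open>2 * m - 1\<close>. For \<open>m = 0\<close>, truncated subtraction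
  gives \<open>double_fact 0 = 1\<close>, in agreement with the convention \<open>(-1)!! = 1\<close>.\<close>

fun double_fact :: "nat \<Rightarrow> nat" where
  "double_fact 0 = 1"
| "double_fact (Suc 0) = 1"
| "double_fact (Suc (Suc k)) = Suc (Suc k) * double_fact k"

definition double_fact_prod :: "nat list \<Rightarrow> nat" where
  "double_fact_prod lam = (\<Prod>m\<leftarrow>lam. double_fact (2 * m - 1))"

definition perfect_matching :: "nat \<Rightarrow> nat set set \<Rightarrow> bool" where
  "perfect_matching n M \<longleftrightarrow> partition_on {1..2 * n} M \<and> (\<forall>e\<in>M. card e = 2)"

definition has_double_shape :: "nat \<Rightarrow> nat list \<Rightarrow> nat set set \<Rightarrow> bool" where
  "has_double_shape n lam P \<longleftrightarrow>
     partition_on {1..2 * n} P \<and> image_mset card (mset_set P) = mset (map (\<lambda>m. 2 * m) lam)"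

definition factorisation :: "nat \<Rightarrow> nat list \<Rightarrow> nat set set set \<Rightarrow> nat \<Rightarrow> bool" where
  "factorisation n lam D c \<longleftrightarrow>
     D \<noteq> {} \<and> (\<forall>M\<in>D. perfect_matching n M) \<and>
     (\<forall>P. has_double_shape n lam P \<longrightarrow> card {M \<in> D. refines {1..2 * n} M P} = c)"

end

theory Submission
  imports Defs
begin

text \<open>A set partition into even blocks is encoded as a colouring of the points, so that zero parts
  (empty colour classes) cause no trouble. After subtracting a suitable constant from the indicator
  function of \<open>D\<close>, it suffices to show: if a weight function on matchings sums to zero over the
  monochromatic matchings of every colouring of shape \<open>2\<lambda>\<close>, then it does so for every \<open>\<mu>\<close>
  dominating \<open>\<lambda>\<close>; by a chain in the dominance order only moves of one unit from a part \<open>b\<close> to a part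
  \<open>a \<ge> b\<close> matter. Fix the other colours, and let \<open>W\<close> be the \<open>2a + 2b\<close> points of the two
  colours. For \<open>A \<subseteq> W\<close> let \<open>h A\<close> be the weight of the matchings for which the colouring with
  classes \<open>A\<close> and \<open>W - A\<close> is monochromatic. Exchanging a point for its partner shows that
  \<open>h (A - v)\<close> summed over \<open>v \<in> A\<close> equals \<open>h (A + v)\<close> summed over \<open>v \<in> W - A\<close>. If \<open>h\<close> vanishes
  on \<open>2b\<close>-sets, then its restriction to \<open>(2b - 2)\<close>-sets lies in the kernel of the
  inclusion map to \<open>(2b - 1)\<close>-sets, which is injective because \<open>2(2b - 2) < 2a + 2b\<close>.\<close>

section \<open>Functions on the \<open>k\<close>-subsets of a finite set\<close>

text \<open>Exchanging single elements never changes \<open>h\<close>, so the hypothesis for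
  \<open>B\<close> with one point added reads \<open>(k + 1) * h B = 0\<close>. The inductive step
  discards two points of \<open>W\<close> while \<open>k\<close> drops by one, which preserves
  \<open>2 * k < card W\<close>.\<close>

lemma subset_function_eq_zero:
  fixes h :: "'a set \<Rightarrow> int"
  assumes "finite W" "2 * k < card W"
    and "\<And>A. A \<subseteq> W \<Longrightarrow> card A = Suc k \<Longrightarrow> (\<Sum>v\<in>A. h (A - {v})) = 0"
    and "B \<subseteq> W" "card B = k"
  shows "h B = 0"
  using assms
proof (induction k arbitrary: W h B)
  case 0
  then obtain w where w: "w \<in> W" by fastforce
  have "B = {}" using "0.prems" finite_subset by fastforce
  then show ?case using "0.prems"(3)[of "{w}"] w by simp
next
  case (Suc k)
  \<comment> \<open>The difference \<open>A \<mapsto> h (A + x) - h (A + y)\<close> satisfies the hypothesis one level lower on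
    \<open>W - {x, y}\<close>, so \<open>h\<close> is invariant under exchanging single elements.\<close>
  have exch: "h (insert x A) = h (insert y A)"
    if "A \<subseteq> W" "card A = k" "x \<in> W - A" "y \<in> W - A" "x \<noteq> y" for x y A
  proof -
    let ?W = "W - {x, y}"
    have "h (insert x A) - h (insert y A) = 0"
    proof (rule Suc.IH[of ?W "\<lambda>A. h (insert x A) - h (insert y A)"])
      show "finite ?W" using Suc.prems(1) by simp
      show "2 * k < card ?W" using Suc.prems(1,2) that by (simp add: card_Diff_subset)
      show "A \<subseteq> ?W" "card A = k" using that by auto
    next
      fix C assume C: "C \<subseteq> ?W" "card C = Suc k"
      have fC: "finite C" using C(2) card.infinite by fastforce
      \<comment> \<open>Deleting \<open>z\<close> from \<open>insert z C\<close> leaves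
        \<open>C\<close> for both choices of \<open>z\<close>, so the two sums agree and cancel in
        the difference.\<close>
      have sum_insert: "(\<Sum>v\<in>C. h (insert z (C - {v}))) = - h C" if "z = x \<or> z = y" for z
      proof -
        have z: "z \<notin> C" "insert z C \<subseteq> W" using C that \<open>x \<in> W - A\<close> \<open>y \<in> W - A\<close> by auto
        have "0 = (\<Sum>v\<in>insert z C. h (insert z C - {v}))"
          using Suc.prems(3)[of "insert z C"] z C fC by simp
        also have "\<dots> = h C + (\<Sum>v\<in>C. h (insert z C - {v}))" using fC z by simp
        also have "(\<Sum>v\<in>C. h (insert z C - {v})) = (\<Sum>v\<in>C. h (insert z (C - {v})))"
          by (rule sum.cong) (use z in \<open>auto simp: insert_Diff_if\<close>)
        finally show ?thesis by simp
      qed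
      show "(\<Sum>v\<in>C. h (insert x (C - {v})) - h (insert y (C - {v}))) = 0"
        by (simp add: sum_subtractf sum_insert)
    qed
    then show ?thesis by simp
  qed
  have fB: "finite B" using Suc.prems(5) card.infinite by fastforce
  have "card B < card W" using Suc.prems by simp
  then obtain x where x: "x \<in> W - B"
    using Suc.prems(4) by (metis DiffI less_irrefl subset_antisym subset_eq)
  \<comment> \<open>Deleting \<open>v\<close> from \<open>insert x B\<close> amounts to exchanging
    \<open>v\<close> for \<open>x\<close> in \<open>B\<close>.\<close>
  have same: "h (insert x B - {v}) = h B" if "v \<in> insert x B" for v
  proof (cases "v = x")
    case False
    with that have v: "v \<in> B" by simp
    have "h (insert x (B - {v})) = h (insert v (B - {v}))"
      by (rule exch) (use Suc.prems x v False fB in auto)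
    then show ?thesis using False v x by (auto simp: insert_Diff_if insert_absorb)
  qed (use x in auto)
  have "0 = (\<Sum>v\<in>insert x B. h (insert x B - {v}))"
    using Suc.prems(3)[of "insert x B"] x Suc.prems(4,5) fB by simp
  also have "\<dots> = of_nat (card (insert x B)) * h B" by (simp add: same)
  finally show ?case using fB by simp
qed

section \<open>Matchings that are monochromatic under a colouring\<close>

definition matching_on :: "'a set \<Rightarrow> 'a set set \<Rightarrow> bool" where
  "matching_on V M \<longleftrightarrow> partition_on V M \<and> (\<forall>e\<in>M. card e = 2)"

definition monochromatic :: "('a \<Rightarrow> nat) \<Rightarrow> 'a set set \<Rightarrow> bool" where
  "monochromatic p M \<longleftrightarrow> (\<forall>e\<in>M. \<forall>x\<in>e. \<forall>y\<in>e. p x = p y)"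

definition mono_matchings :: "'a set \<Rightarrow> ('a \<Rightarrow> nat) \<Rightarrow> 'a set set set" where
  "mono_matchings V p = {M. matching_on V M \<and> monochromatic p M}"

text \<open>Labelled classes turn the transfer of a unit between two parts into a function update of
  \<open>s\<close>.\<close>

definition colour_shape :: "'a set \<Rightarrow> ('a \<Rightarrow> nat) \<Rightarrow> (nat \<Rightarrow> nat) \<Rightarrow> bool" where
  "colour_shape V p s \<longleftrightarrow> (\<forall>i. card {v\<in>V. p v = i} = 2 * s i)"

definition partner :: "'a set set \<Rightarrow> 'a \<Rightarrow> 'a" where
  "partner M v = (THE w. {v, w} \<in> M \<and> w \<noteq> v)"

lemma finite_mono_matchings: "finite V \<Longrightarrow> finite (mono_matchings V p)"
  by (rule finite_subset[OF _ finitely_many_partition_on[of V]])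
     (auto simp: mono_matchings_def matching_on_def)

lemma partner_unique:
  assumes "matching_on V M" "{v, w} \<in> M" "w \<noteq> v"
  shows "partner M v = w"
  unfolding partner_def
proof (rule the_equality)
  fix u assume u: "{v, u} \<in> M \<and> u \<noteq> v"
  have "disjoint M" using assms by (auto simp: matching_on_def partition_on_def)
  then have "{v, u} = {v, w}"
    using u assms(2) by (metis disjoint_def Int_insert_left_if1 insertI1 insert_not_empty)
  then show "u = w" using u assms(3) by (auto simp: doubleton_eq_iff)
qed (use assms in auto)

lemma partner_props:
  assumes "matching_on V M" "v \<in> V"
  shows "{v, partner M v} \<in> M" "partner M v \<noteq> v" "partner M v \<in> V" "partner M (partner M v) = v"
proof -
  obtain e where e: "e \<in> M" "v \<in> e" "card e = 2"
    using assms by (auto simp: matching_on_def partition_on_def)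
  then obtain w where w: "e = {v, w}" "w \<noteq> v" by (auto simp: card_2_iff)
  then have "partner M v = w" using partner_unique[OF assms(1)] e by simp
  moreover have "partner M w = v"
    using partner_unique[OF assms(1), of w v] e w by (simp add: insert_commute)
  ultimately show "{v, partner M v} \<in> M" "partner M v \<noteq> v" "partner M (partner M v) = v"
    using e w by auto
  then show "partner M v \<in> V" using assms by (auto simp: matching_on_def partition_on_def)
qed

lemma matching_edge:
  assumes "matching_on V M" "e \<in> M" "x \<in> e"
  shows "x \<in> V" "e = {x, partner M x}"
proof -
  show "x \<in> V" using assms by (auto simp: matching_on_def partition_on_def)
  have "card e = 2" using assms by (auto simp: matching_on_def)
  with assms(3) obtain w where w: "e = {x, w}" "w \<noteq> x" by (auto simp: card_2_iff)
  then show "e = {x, partner M x}" using partner_unique assms by metis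
qed

lemma monochromatic_iff_partner:
  assumes "matching_on V M"
  shows "monochromatic p M \<longleftrightarrow> (\<forall>v\<in>V. p (partner M v) = p v)"
proof
  assume "monochromatic p M"
  then show "\<forall>v\<in>V. p (partner M v) = p v"
    using partner_props(1)[OF assms] unfolding monochromatic_def by (meson insertI1 insertI2)
next
  assume *: "\<forall>v\<in>V. p (partner M v) = p v"
  show "monochromatic p M"
    unfolding monochromatic_def
  proof (intro ballI)
    fix e x y assume "e \<in> M" "x \<in> e" "y \<in> e"
    then have "x \<in> V" "y = x \<or> y = partner M x" using matching_edge[OF assms] by blast+
    then show "p x = p y" using * by auto
  qed
qed

section \<open>Exchanging a point for its partner across two colour classes\<close>

definition recolour :: "('a \<Rightarrow> nat) \<Rightarrow> 'a set \<Rightarrow> nat \<Rightarrow> nat \<Rightarrow> 'a set \<Rightarrow> 'a \<Rightarrow> nat" where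
  "recolour p W i j A v = (if v \<in> A then j else if v \<in> W then i else p v)"

text \<open>If moving \<open>v\<close> out of \<open>A\<close> makes \<open>M\<close> monochromatic, then so does moving its partner into \<open>A\<close>
  instead; taking partners is thus a bijection between the two index sets.\<close>

lemma card_mono_exchange:
  fixes p :: "'a \<Rightarrow> nat"
  assumes M: "matching_on V M" and V: "finite V" and ij: "i \<noteq> j"
    and W: "W = {v\<in>V. p v = i \<or> p v = j}" and A: "A \<subseteq> W"
  shows "card {v\<in>A. monochromatic (recolour p W i j (A - {v})) M}
       = card {v\<in>W - A. monochromatic (recolour p W i j (insert v A)) M}" (is "card ?S = card ?T")
proof (rule bij_betw_same_card[of "partner M"], rule bij_betw_byWitness[where f' = "partner M"])
  note mono = monochromatic_iff_partner[OF M]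
  note P = partner_props[OF M]
  have WV: "W \<subseteq> V" using W by auto
  show "\<forall>v\<in>?S. partner M (partner M v) = v" "\<forall>v\<in>?T. partner M (partner M v) = v"
    using P A WV by auto
  show "partner M ` ?S \<subseteq> ?T"
  proof (rule image_subsetI)
    fix v assume v: "v \<in> ?S"
    let ?w = "partner M v"
    have vV: "v \<in> V" using v A WV by auto
    have eq: "recolour p W i j (A - {v}) (partner M u) = recolour p W i j (A - {v}) u"
      if "u \<in> V" for u using v that mono by blast
    \<comment> \<open>Here \<open>v\<close> has colour \<open>i\<close>, hence so has its partner;
      as \<open>W\<close> contains every point that \<open>p\<close> colours \<open>i\<close>, the
      partner lies in \<open>W\<close> and outside \<open>A\<close>.\<close>
    have "?w \<in> W - A"
      using eq[OF vV] v A ij P[OF vV] by (auto simp: recolour_def W split: if_splits)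
    moreover have "recolour p W i j (insert ?w A) (partner M u) = recolour p W i j (insert ?w A) u"
      if u: "u \<in> V" for u
    \<comment> \<open>The two recolourings differ only at \<open>v\<close> and \<open>?w\<close>,
      which now both have colour \<open>j\<close>; every other point has its partner outside this
      pair.\<close>
    proof (cases "u = v \<or> u = ?w")
      case True
      then show ?thesis using v P[OF vV] by (auto simp: recolour_def)
    next
      case False
      then have "partner M u \<noteq> v" "partner M u \<noteq> ?w" using P[OF u] P[OF vV] by metis+
      then show ?thesis using eq[OF u] False by (simp add: recolour_def)
    qed
    ultimately show "?w \<in> ?T" using mono by blast
  qed
  show "partner M ` ?T \<subseteq> ?S"
  proof (rule image_subsetI)
    fix v assume v: "v \<in> ?T"
    let ?w = "partner M v"
    have vV: "v \<in> V" using v WV by auto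
    have eq: "recolour p W i j (insert v A) (partner M u) = recolour p W i j (insert v A) u"
      if "u \<in> V" for u using v that mono by blast
    \<comment> \<open>Now \<open>v\<close> has colour \<open>j\<close>, so its partner is a point of
      \<open>insert v A\<close> other than \<open>v\<close>.\<close>
    have w: "?w \<in> A"
      using eq[OF vV] v A ij P[OF vV] by (auto simp: recolour_def W split: if_splits)
    moreover have "recolour p W i j (A - {?w}) (partner M u) = recolour p W i j (A - {?w}) u"
      if u: "u \<in> V" for u
    proof (cases "u = v \<or> u = ?w")
      case True
      then show ?thesis using v w A P[OF vV] by (auto simp: recolour_def)
    next
      case False
      then have "partner M u \<noteq> v" "partner M u \<noteq> ?w" using P[OF u] P[OF vV] by metis+
      then show ?thesis using eq[OF u] False by (simp add: recolour_def)
    qed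
    ultimately show "?w \<in> ?S" using mono by blast
  qed
qed

text \<open>Double counting: after interchanging the sums, the coefficient of each
  \<open>f M\<close> is a number of points \<open>v\<close>, and the two coefficients agree by the
  exchange of partners.\<close>

lemma sum_mono_exchange:
  fixes p :: "'a \<Rightarrow> nat" and f :: "'a set set \<Rightarrow> int"
  assumes V: "finite V" and ij: "i \<noteq> j"
    and W: "W = {v\<in>V. p v = i \<or> p v = j}" and A: "A \<subseteq> W"
  shows "(\<Sum>v\<in>A. sum f (mono_matchings V (recolour p W i j (A - {v}))))
       = (\<Sum>v\<in>W - A. sum f (mono_matchings V (recolour p W i j (insert v A))))"
proof -
  let ?X = "{M. matching_on V M}"
  have finX: "finite ?X"
    by (rule finite_subset[OF _ finitely_many_partition_on[of V]]) (auto simp: matching_on_def V)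
  have finW: "finite W" using V W by simp
  then have finA: "finite A" using A finite_subset by blast
  have swap: "(\<Sum>v\<in>B. sum f (mono_matchings V (q v)))
      = (\<Sum>M\<in>?X. of_nat (card {v\<in>B. monochromatic (q v) M}) * f M)"
    if B: "finite B" for B :: "'a set" and q
  proof -
    have "(\<Sum>v\<in>B. sum f (mono_matchings V (q v)))
        = (\<Sum>v\<in>B. \<Sum>M\<in>?X. if monochromatic (q v) M then f M else 0)"
      by (rule sum.cong[OF refl]) (simp add: mono_matchings_def sum.inter_filter[OF finX, symmetric])
    also have "\<dots> = (\<Sum>M\<in>?X. \<Sum>v\<in>B. if monochromatic (q v) M then f M else 0)"
      by (rule sum.swap)
    also have "\<dots> = (\<Sum>M\<in>?X. of_nat (card {v\<in>B. monochromatic (q v) M}) * f M)"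
      by (rule sum.cong[OF refl]) (simp add: sum.inter_filter[OF B, symmetric])
    finally show ?thesis .
  qed
  show ?thesis
    using card_mono_exchange[OF _ V ij W A] finA finW by (simp add: swap)
qed

lemma sum_mono_matchings_zero_step:
  fixes f :: "'a set set \<Rightarrow> int"
  assumes V: "finite V" and ij: "i \<noteq> j" and s: "0 < s j" "s j \<le> s i"
    and zero: "\<And>p. colour_shape V p s \<Longrightarrow> sum f (mono_matchings V p) = 0"
    and p: "colour_shape V p (s(i := s i + 1, j := s j - 1))"
  shows "sum f (mono_matchings V p) = 0"
proof -
  define W where "W = {v\<in>V. p v = i \<or> p v = j}"
  define h where "h A = sum f (mono_matchings V (recolour p W i j A))" for A
  let ?B = "{v\<in>V. p v = j}"
  have cards: "card {v\<in>V. p v = i} = 2 * (s i + 1)" "card ?B = 2 * (s j - 1)"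
    "\<And>l. l \<noteq> i \<Longrightarrow> l \<noteq> j \<Longrightarrow> card {v\<in>V. p v = l} = 2 * s l"
    using p ij by (auto simp: colour_shape_def)
  have finW: "finite W" using V by (simp add: W_def)
  have "W = {v\<in>V. p v = i} \<union> ?B" by (auto simp: W_def)
  moreover have "card \<dots> = 2 * (s i + 1) + 2 * (s j - 1)"
    by (subst card_Un_disjoint) (use V ij cards in auto)
  ultimately have cardW: "card W = 2 * s i + 2 * s j" using s by simp
  \<comment> \<open>The rest of \<open>W\<close> has \<open>2 * s i\<close> points, so the
    recolouring has shape \<open>s\<close>.\<close>
  have h0: "h A = 0" if A: "A \<subseteq> W" "card A = 2 * s j" for A
    unfolding h_def
  proof (rule zero, unfold colour_shape_def, rule allI)
    fix l
    consider "l = i" | "l = j" | "l \<noteq> i" "l \<noteq> j" by blast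
    then show "card {v\<in>V. recolour p W i j A v = l} = 2 * s l"
    proof cases
      case 1
      have "{v\<in>V. recolour p W i j A v = l} = W - A"
        using A ij 1 by (auto simp: recolour_def W_def)
      then show ?thesis
        using A cardW finW 1 by (simp add: card_Diff_subset finite_subset)
    next
      case 2
      have "{v\<in>V. recolour p W i j A v = l} = A"
        using A ij 2 by (auto simp: recolour_def W_def)
      then show ?thesis using A 2 by simp
    next
      case 3
      have "{v\<in>V. recolour p W i j A v = l} = {v\<in>V. p v = l}"
        using A ij 3 by (auto simp: recolour_def W_def)
      then show ?thesis using cards 3 by simp
    qed
  qed
  have "h ?B = 0"
  proof (rule subset_function_eq_zero[OF finW])
    \<comment> \<open>This is \<open>4 * s j - 4 < 2 * s i + 2 * s j\<close>, a consequence of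
      \<open>s j \<le> s i\<close>.\<close>
    show "2 * (2 * (s j - 1)) < card W" using s cardW by simp
    show "?B \<subseteq> W" by (auto simp: W_def)
    show "card ?B = 2 * (s j - 1)" by (rule cards)
    fix A assume A: "A \<subseteq> W" "card A = Suc (2 * (s j - 1))"
    have finA: "finite A" using A finW finite_subset by blast
    \<comment> \<open>Since \<open>A\<close> has \<open>2 * s j - 1\<close> points, the exchange
      leads from sets one smaller to sets of size \<open>2 * s j\<close>, where \<open>h\<close>
      vanishes.\<close>
    have "(\<Sum>v\<in>A. h (A - {v})) = (\<Sum>v\<in>W - A. h (insert v A))"
      unfolding h_def by (rule sum_mono_exchange[OF V ij W_def A(1)])
    also have "\<dots> = 0"
      by (rule sum.neutral, rule ballI, rule h0) (use A finA s in auto)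
    finally show "(\<Sum>v\<in>A. h (A - {v})) = 0" .
  qed
  moreover have "recolour p W i j ?B = p" by (auto simp: recolour_def W_def fun_eq_iff)
  ultimately show ?thesis by (simp add: h_def)
qed

section \<open>Dominance order\<close>

text \<open>Induction on the total gap between the partial sums of \<open>t\<close> and
  \<open>s\<close>. Equality from \<open>N\<close> on confines the gaps to indices below
  \<open>N\<close>, and the inequality between partial sums makes the truncated differences true
  ones.\<close>

lemma dominance_induct :
  fixes s t :: "nat \<Rightarrow> nat"
  assumes "antimono s" "antimono t"
    and "\<And>k. (\<Sum>l<k. s l) \<le> (\<Sum>l<k. t l)"
    and "\<And>k. k \<ge> N \<Longrightarrow> (\<Sum>l<k. s l) = (\<Sum>l<k. t l)"
    and base: "Q s"
    and step: "\<And>s i j. Q s \<Longrightarrow> i \<noteq> j \<Longrightarrow> 0 < s j \<Longrightarrow> s j \<le> s i \<Longrightarrow> Q (s(i := s i + 1, j := s j - 1))"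
  shows "Q t"
  using assms(1-5)
proof (induction "\<Sum>k<N. (\<Sum>l<k. t l) - (\<Sum>l<k. s l)" arbitrary: s rule: less_induct)
  case less
  define S where "S s k = (\<Sum>l<k. s l)" for s :: "nat \<Rightarrow> nat" and k
  have S_Suc: "S r (Suc k) = S r k + r k" for r k by (simp add: S_def)
  have S_le: "S s k \<le> S t k" for k using less.prems(3) by (simp add: S_def)
  have S_eq: "S s k = S t k" if "k \<ge> N" for k using less.prems(4) that by (simp add: S_def)
  show ?case
  proof (cases "s = t")
    case True
    then show ?thesis using less.prems by simp
  next
    case False
    \<comment> \<open>Move a unit from \<open>j\<close> to \<open>i\<close>, where \<open>i\<close> is the first index at which the parts differ and
      \<open>j\<close> the last one before the partial sums agree again; this keeps \<open>s\<close> decreasing.\<close>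
    define i where "i = (LEAST i. s i \<noteq> t i)"
    have "\<exists>i. s i \<noteq> t i" using False by auto
    then have i: "s i \<noteq> t i" unfolding i_def by (rule LeastI_ex)
    have below: "s l = t l" if "l < i" for l using not_less_Least that unfolding i_def by blast
    have "S s i = S t i" unfolding S_def by (rule sum.cong) (auto simp: below)
    then have si: "s i < t i" using S_le[of "Suc i"] i by (simp add: S_Suc)
    define k where "k = (LEAST k. i < k \<and> S s k = S t k)"
    \<comment> \<open>A suitable index exists because the partial sums agree from \<open>N\<close>
      on.\<close>
    have "i < i + N + 1 \<and> S s (i + N + 1) = S t (i + N + 1)" using S_eq by simp
    then have k: "i < k" "S s k = S t k" unfolding k_def by (metis (mono_tags, lifting) LeastI)+
    have k_min: "S s l < S t l" if "i < l" "l < k" for l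
      using not_less_Least[of l] that S_le[of l] unfolding k_def by (metis (mono_tags, lifting) le_neq_implies_less)
    have "k \<noteq> Suc i" using k(2) \<open>S s i = S t i\<close> si by (auto simp: S_Suc)
    then obtain j where j: "k = Suc j" "i < j" using k(1) by (cases k) auto
    have sj: "t j < s j" using k_min[of j] j k(2) by (simp add: S_Suc)
    \<comment> \<open>Needed at the drop from \<open>j\<close> to \<open>k\<close>:
      \<open>s k \<le> t k \<le> t j < s j\<close> leaves room to lower \<open>s j\<close> by
      one.\<close>
    have sSk: "s k \<le> t k" using S_le[of "Suc k"] k(2) by (simp add: S_Suc)
    have jN: "j < N" using k_min[of j] j S_eq[of j] by (cases "j < N") auto
    define s' where "s' = s(i := s i + 1, j := s j - 1)"
    \<comment> \<open>Only the partial sums of lengths \<open>i + 1\<close> to \<open>j\<close>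
      grow, by one each; by the choice of \<open>k\<close> these were strictly below those of
      \<open>t\<close>.\<close>
    have S': "S s' l = S s l + (if i < l \<and> l \<le> j then 1 else 0)" for l
    proof (induction l)
      case (Suc l)
      then show ?case using j sj by (auto simp: S_Suc s'_def)
    qed (simp add: S_def)
    have S'_le: "S s' l \<le> S t l" for l
      using S_le[of l] k_min[of l] j by (auto simp: S')
    show ?thesis
    proof (rule less.hyps[of s'])
      show "antimono s'"
      proof (rule decseq_SucI)
        fix l
        have ds: "s (Suc l) \<le> s l" and dt: "t (Suc l) \<le> t l"
          using less.prems(1,2) by (auto simp: decseq_Suc_iff)
        \<comment> \<open>If \<open>Suc l = i\<close>, the raised part is still bounded by its
          predecessor: \<open>s i + 1 \<le> t i \<le> t l = s l\<close>.\<close>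
        show "s' (Suc l) \<le> s' l"
        proof (cases "Suc l = i")
          case True
          then have "s l = t l" using below by simp
          then show ?thesis using True si dt j by (auto simp: s'_def)
        next
          case False
          then show ?thesis using ds dt j sj sSk by (auto simp: s'_def)
        qed
      qed
      show "antimono t" by (rule less.prems)
      show "(\<Sum>l<m. s' l) \<le> (\<Sum>l<m. t l)" for m using S'_le[of m] by (simp add: S_def)
      show "(\<Sum>l<m. s' l) = (\<Sum>l<m. t l)" if "m \<ge> N" for m
        using S'[of m] S_eq[of m] that jN by (simp add: S_def)
      have "s j \<le> s i" using less.prems(1) j by (simp add: antimonoD)
      then show "Q s'" unfolding s'_def using step[OF less.prems(5)] j sj by simp
      have "(\<Sum>k<N. S t k - S s' k) < (\<Sum>k<N. S t k - S s k)"
      proof (rule sum_strict_mono_ex1)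
        show "finite {..<N}" by simp
        show "\<forall>l\<in>{..<N}. S t l - S s' l \<le> S t l - S s l" by (auto simp: S')
        show "\<exists>l\<in>{..<N}. S t l - S s' l < S t l - S s l"
          using k_min[of j] j jN by (intro bexI[of _ j]) (auto simp: S')
      qed
      then show "(\<Sum>k<N. (\<Sum>l<k. t l) - (\<Sum>l<k. s' l)) < (\<Sum>k<N. (\<Sum>l<k. t l) - (\<Sum>l<k. s l))"
        by (simp add: S_def)
    qed
  qed
qed

lemma sum_mono_matchings_zero_dominance:
  fixes f :: "'a set set \<Rightarrow> int" and s t :: "nat \<Rightarrow> nat"
  assumes V: "finite V" and st: "antimono s" "antimono t"
    "\<And>k. (\<Sum>l<k. s l) \<le> (\<Sum>l<k. t l)" "\<And>k. k \<ge> N \<Longrightarrow> (\<Sum>l<k. s l) = (\<Sum>l<k. t l)"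
    and zero: "\<And>p. colour_shape V p s \<Longrightarrow> sum f (mono_matchings V p) = 0"
    and p: "colour_shape V p t"
  shows "sum f (mono_matchings V p) = 0"
proof -
  have "\<forall>p. colour_shape V p t \<longrightarrow> sum f (mono_matchings V p) = 0"
  proof (rule dominance_induct[OF st, where Q = "\<lambda>s. \<forall>p. colour_shape V p s \<longrightarrow> sum f (mono_matchings V p) = 0"])
    show "\<forall>p. colour_shape V p s \<longrightarrow> sum f (mono_matchings V p) = 0" using zero by blast
  qed (use sum_mono_matchings_zero_step[OF V] in blast)+
  then show ?thesis using p by blast
qed

section \<open>Counting monochromatic matchings\<close>

lemma matching_on_insert_edge:
  assumes "v \<in> V" "w \<in> V" "v \<noteq> w" "matching_on (V - {v, w}) M"
  shows "matching_on V (insert {v, w} M)"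
proof -
  have "disjnt {v, w} (\<Union>M)"
    using assms(4) by (auto simp: matching_on_def partition_on_def)
  then show ?thesis
    using assms by (auto simp: matching_on_def partition_on_insert)
qed

lemma matching_on_remove_edge:
  assumes "matching_on V M" "e \<in> M"
  shows "matching_on (V - e) (M - {e})"
proof -
  have M: "partition_on V M" using assms by (simp add: matching_on_def)
  then have "disjnt e (\<Union>(M - {e}))"
    using assms(2) by (force simp: partition_on_def disjoint_def disjnt_def)
  moreover have "insert e (M - {e}) = M" using assms(2) by auto
  ultimately show ?thesis
    using partition_on_insert[of e "M - {e}" V] M assms by (auto simp: matching_on_def)
qed

text \<open>For \<open>m = 2\<close> the truncated \<open>m - 2 - 1\<close> is \<open>0\<close>, and
  \<open>double_fact 0 = 1\<close> supplies the convention for (-1)!!.\<close>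

lemma double_fact_odd_rec:
  assumes "even m" "0 < m"
  shows "double_fact (m - 1) = (m - 1) * double_fact (m - 2 - 1)"
proof -
  obtain b where b: "m = 2 * b" using assms(1) by (auto elim: evenE)
  then obtain k where k: "m = 2 * Suc k" using assms(2) by (cases b) auto
  then show ?thesis by (cases k) simp_all
qed

lemma monochromatic_insert:
  "monochromatic p (insert e M) \<longleftrightarrow> (\<forall>x\<in>e. \<forall>y\<in>e. p x = p y) \<and> monochromatic p M"
  by (simp add: monochromatic_def)

lemma mono_matchings_decompose:
  assumes "v \<in> V"
  shows "mono_matchings V p =
    (\<Union>w\<in>{w\<in>V. p w = p v} - {v}. insert {v, w} ` mono_matchings (V - {v, w}) p)"
proof (intro equalityI subsetI)
  fix M assume M: "M \<in> mono_matchings V p"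
  then have mV: "matching_on V M" and mono: "monochromatic p M" by (auto simp: mono_matchings_def)
  note P = partner_props[OF mV assms]
  have "p (partner M v) = p v" using mono monochromatic_iff_partner[OF mV] assms by blast
  moreover have "M - {{v, partner M v}} \<in> mono_matchings (V - {v, partner M v}) p"
    using matching_on_remove_edge[OF mV P(1)] mono by (auto simp: mono_matchings_def monochromatic_def)
  moreover have "M = insert {v, partner M v} (M - {{v, partner M v}})" using P(1) by auto
  ultimately show "M \<in> (\<Union>w\<in>{w\<in>V. p w = p v} - {v}. insert {v, w} ` mono_matchings (V - {v, w}) p)"
    using P by blast
next
  fix M assume "M \<in> (\<Union>w\<in>{w\<in>V. p w = p v} - {v}. insert {v, w} ` mono_matchings (V - {v, w}) p)"
  then obtain w N where w: "w \<in> V" "p w = p v" "w \<noteq> v" "M = insert {v, w} N"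
    "matching_on (V - {v, w}) N" "monochromatic p N"
    by (auto simp: mono_matchings_def)
  have "matching_on V M" using matching_on_insert_edge[OF assms, of w N] w(1,3-5) by simp
  moreover have "monochromatic p M" using w(2,4,6) by (simp add: monochromatic_insert)
  ultimately show "M \<in> mono_matchings V p" by (simp add: mono_matchings_def)
qed

lemma card_mono_matchings:
  assumes "finite V" "finite I" "p ` V \<subseteq> I" "\<And>i. even (card {v\<in>V. p v = i})"
  shows "card (mono_matchings V p) = (\<Prod>i\<in>I. double_fact (card {v\<in>V. p v = i} - 1))"
  using assms
proof (induction "card V" arbitrary: V rule: less_induct)
  case less
  show ?case
  proof (cases "V = {}")
    case True
    then have "mono_matchings V p = {{}}"
      by (auto simp: mono_matchings_def matching_on_def monochromatic_def partition_on_empty)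
    then show ?thesis using True by simp
  next
    case False
    then obtain v where v: "v \<in> V" by blast
    let ?C = "\<lambda>i. {u\<in>V. p u = i}"
    let ?K = "?C (p v) - {v}"
    let ?R = "\<Prod>i\<in>I - {p v}. double_fact (card (?C i) - 1)"
    have c: "card ?K = card (?C (p v)) - 1" using v less.prems(1) by simp
    have cpos: "0 < card (?C (p v))" using v less.prems(1) by (auto simp: card_gt_0_iff)
    have sub: "card (mono_matchings (V - {v, w}) p) = double_fact (card (?C (p v)) - 2 - 1) * ?R"
      if w: "w \<in> ?K" for w
    proof -
      let ?V = "V - {v, w}"
      have "{u\<in>?V. p u = p v} = ?C (p v) - {v, w}" by auto
      moreover have "card (?C (p v) - {v, w}) = card (?C (p v)) - 2"
        using v w less.prems(1) by (subst card_Diff_subset) auto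
      ultimately have cv: "card {u\<in>?V. p u = p v} = card (?C (p v)) - 2" by simp
      have ci: "{u\<in>?V. p u = i} = ?C i" if "i \<noteq> p v" for i using w that by auto
      have "card (mono_matchings ?V p) = (\<Prod>i\<in>I. double_fact (card {u\<in>?V. p u = i} - 1))"
      proof (rule less.hyps)
        show "card ?V < card V" using v less.prems(1) by (intro psubset_card_mono) auto
        show "even (card {u\<in>?V. p u = i})" for i
          using cv ci[of i] less.prems(4)[of i] by (cases "i = p v") auto
      qed (use less.prems in auto)
      also have "\<dots> = double_fact (card {u\<in>?V. p u = p v} - 1)
          * (\<Prod>i\<in>I - {p v}. double_fact (card {u\<in>?V. p u = i} - 1))"
        using v less.prems(2,3) by (intro prod.remove) auto
      also have "(\<Prod>i\<in>I - {p v}. double_fact (card {u\<in>?V. p u = i} - 1)) = ?R"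
      proof (rule prod.cong[OF refl])
        fix i assume "i \<in> I - {p v}"
        then have "i \<noteq> p v" by simp
        from ci[OF this] show "double_fact (card {u\<in>?V. p u = i} - 1) = double_fact (card (?C i) - 1)"
          by simp
      qed
      also note cv
      finally show ?thesis .
    qed
    have inj: "inj_on (insert {v, w}) (mono_matchings (V - {v, w}) p)" for w
    proof (rule inj_onI)
      fix M N assume MN: "M \<in> mono_matchings (V - {v, w}) p" "N \<in> mono_matchings (V - {v, w}) p"
        "insert {v, w} M = insert {v, w} N"
      have "{v, w} \<notin> X" if "X \<in> mono_matchings (V - {v, w}) p" for X
        using that unfolding mono_matchings_def matching_on_def partition_on_def by blast
      then show "M = N" using MN by (metis insert_ident)
    qed
    \<comment> \<open>The partner of \<open>v\<close> tells the families for different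
      \<open>w\<close> apart.\<close>
    have disj: "insert {v, w} ` mono_matchings (V - {v, w}) p \<inter>
        insert {v, w'} ` mono_matchings (V - {v, w'}) p = {}"
      if "w \<in> ?K" "w' \<in> ?K" "w \<noteq> w'" for w w'
    proof -
      have "partner X u = u'"
        if "u = v" "u' \<in> ?K" "X \<in> insert {v, u'} ` mono_matchings (V - {v, u'}) p" for X u u'
        using that v matching_on_insert_edge[OF v, of u']
        by (intro partner_unique[of V]) (auto simp: mono_matchings_def)
      from this[OF refl that(1)] this[OF refl that(2)] show ?thesis
        using that(3) by (metis disjoint_iff)
    qed
    have "card (mono_matchings V p) = (\<Sum>w\<in>?K. card (insert {v, w} ` mono_matchings (V - {v, w}) p))"
      unfolding mono_matchings_decompose[OF v]
      by (rule card_UN_disjoint) (use less.prems(1) disj in \<open>auto simp: finite_mono_matchings\<close>)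
    also have "\<dots> = (\<Sum>w\<in>?K. double_fact (card (?C (p v)) - 2 - 1) * ?R)"
      by (rule sum.cong[OF refl]) (simp only: card_image[OF inj] sub)
    also have "\<dots> = double_fact (card (?C (p v)) - 1) * ?R"
      using double_fact_odd_rec[OF less.prems(4) cpos] c by simp
    also have "\<dots> = (\<Prod>i\<in>I. double_fact (card (?C i) - 1))"
      using v less.prems(2,3) by (intro prod.remove[symmetric]) auto
    finally show ?thesis .
  qed
qed

section \<open>Colourings and set partitions\<close>

text \<open>Zero padding puts partitions of different lengths on one index set, as the induction
  along dominance requires.\<close>

definition parts :: "nat list \<Rightarrow> nat \<Rightarrow> nat" where
  "parts lam i = (if i < length lam then lam ! i else 0)"

definition colour_classes :: "'a set \<Rightarrow> ('a \<Rightarrow> nat) \<Rightarrow> nat \<Rightarrow> 'a set set" where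
  "colour_classes V p L = (\<lambda>i. {v\<in>V. p v = i}) ` {..<L}"

lemma sum_parts: "(\<Sum>i<k. parts lam i) = sum_list (take k lam)"
proof (induction k)
  case (Suc k)
  then show ?case
    by (cases "k < length lam") (simp_all add: parts_def take_Suc_conv_app_nth)
qed simp

lemma antimono_parts:
  assumes "number_partition n lam"
  shows "antimono (parts lam)"
proof (rule antimonoI)
  fix i j :: nat assume "i \<le> j"
  then show "parts lam j \<le> parts lam i"
    using assms sorted_wrt_nth_less[of "(\<ge>)" lam i j]
    by (cases "i = j") (auto simp: parts_def number_partition_def)
qed

lemma colour_shape_parts_range:
  assumes "finite V" "colour_shape V p (parts lam)" "v \<in> V"
  shows "p v < length lam"
proof (rule ccontr)
  assume "\<not> p v < length lam"
  then have "card {u\<in>V. p u = p v} = 0" using assms(2) by (simp add: colour_shape_def parts_def)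
  then show False using assms(1,3) by auto
qed

lemma card_mono_matchings_parts:
  assumes "finite V" "colour_shape V p (parts lam)"
  shows "card (mono_matchings V p) = double_fact_prod lam"
proof -
  have "card (mono_matchings V p) = (\<Prod>i\<in>{..<length lam}. double_fact (card {v\<in>V. p v = i} - 1))"
    by (rule card_mono_matchings)
       (use assms colour_shape_parts_range[OF assms] in \<open>auto simp: colour_shape_def\<close>)
  also have "\<dots> = (\<Prod>i<length lam. double_fact (2 * lam ! i - 1))"
    by (rule prod.cong) (use assms(2) in \<open>auto simp: colour_shape_def parts_def\<close>)
  also have "\<dots> = double_fact_prod lam"
    by (simp add: double_fact_prod_def prod.list_conv_set_nth atLeast0LessThan)
  finally show ?thesis .
qed

text \<open>Cut off \<open>2 * m\<close> points as colour \<open>0\<close> and shift the colouring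
  of the rest by one.\<close>

lemma ex_colour_shape_parts:
  assumes "finite V" "card V = 2 * sum_list lam"
  shows "\<exists>p. colour_shape V p (parts lam)"
  using assms
proof (induction lam arbitrary: V)
  case Nil
  then show ?case by (auto simp: colour_shape_def parts_def)
next
  case (Cons m lam)
  obtain A where A: "A \<subseteq> V" "card A = 2 * m"
    using Cons.prems by (metis obtain_subset_with_card_n le_add1 distrib_left sum_list.Cons)
  then have "card (V - A) = 2 * sum_list lam"
    using Cons.prems by (simp add: card_Diff_subset finite_subset)
  then obtain q where q: "colour_shape (V - A) q (parts lam)"
    using Cons.IH[of "V - A"] Cons.prems by auto
  let ?p = "\<lambda>v. if v \<in> A then 0 else Suc (q v)"
  have "card {v\<in>V. ?p v = i} = 2 * parts (m # lam) i" for i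
  proof (cases i)
    case 0
    then have "{v\<in>V. ?p v = i} = A" using A by auto
    then show ?thesis using A 0 by (simp add: parts_def)
  next
    case (Suc k)
    then have "{v\<in>V. ?p v = i} = {v\<in>V - A. q v = k}" by auto
    then show ?thesis using q Suc by (simp add: colour_shape_def parts_def)
  qed
  then have "colour_shape V ?p (parts (m # lam))" by (simp add: colour_shape_def)
  then show ?case by blast
qed

lemma partition_on_colour_classes:
  assumes "finite V" "\<forall>m\<in>set lam. 0 < m" "colour_shape V p (parts lam)"
  shows "partition_on V (colour_classes V p (length lam))"
proof (rule partition_onI)
  show "\<Union>(colour_classes V p (length lam)) = V"
    using colour_shape_parts_range[OF assms(1,3)] by (auto simp: colour_classes_def)
  show "{} \<notin> colour_classes V p (length lam)"
  proof
    assume "{} \<in> colour_classes V p (length lam)"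
    then obtain i where i: "i < length lam" "{v\<in>V. p v = i} = {}" by (auto simp: colour_classes_def)
    then have "lam ! i = 0" using assms(3) by (metis card.empty colour_shape_def mult_eq_0_iff parts_def zero_neq_numeral)
    then show False using assms(2) i by (metis less_irrefl nth_mem)
  qed
qed (auto simp: colour_classes_def disjnt_def)

lemma has_double_shape_colour_classes:
  assumes "\<forall>m\<in>set lam. 0 < m" "colour_shape {1..2 * n} p (parts lam)"
  shows "has_double_shape n lam (colour_classes {1..2 * n} p (length lam))"
proof -
  let ?V = "{1..2 * n}" and ?L = "length lam"
  have part: "partition_on ?V (colour_classes ?V p ?L)"
    by (rule partition_on_colour_classes[OF _ assms]) simp
  \<comment> \<open>Positive parts give non-empty classes, so distinct colours give distinct blocks
    and no multiplicity is lost in passing to a set of blocks.\<close>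
  have "inj_on (\<lambda>i. {v\<in>?V. p v = i}) {..<?L}"
  proof (rule inj_onI)
    fix i j assume ij: "i \<in> {..<?L}" "j \<in> {..<?L}" "{v\<in>?V. p v = i} = {v\<in>?V. p v = j}"
    have "{v\<in>?V. p v = i} \<noteq> {}" using part ij by (auto simp: partition_on_def colour_classes_def)
    then show "i = j" using ij(3) by blast
  qed
  then have "image_mset card (mset_set (colour_classes ?V p ?L))
      = image_mset (\<lambda>i. card {v\<in>?V. p v = i}) (mset_set {..<?L})"
    by (simp add: colour_classes_def image_mset_mset_set[symmetric] image_mset.compositionality o_def)
  also have "\<dots> = image_mset (\<lambda>i. 2 * lam ! i) (mset_set {..<?L})"
    by (rule image_mset_cong) (use assms(2) in \<open>auto simp: colour_shape_def parts_def atLeast0LessThan\<close>)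
  also have "\<dots> = mset (map (\<lambda>m. 2 * m) (map ((!) lam) [0..<?L]))"
    by (simp add: image_mset.compositionality o_def mset_upt atLeast0LessThan)
  finally show ?thesis using part by (simp add: has_double_shape_def map_nth)
qed

text \<open>Lets the blocks of a set partition be listed in the order of the parts of
  \<open>lam\<close>.\<close>

lemma image_mset_eq_mset_obtain_list:
  assumes "image_mset f M = mset ys"
  obtains xs where "mset xs = M" "map f xs = ys"
proof -
  have "\<exists>xs. mset xs = M \<and> map f xs = ys"
    using assms
  proof (induction ys arbitrary: M)
    case (Cons y ys)
    then obtain N x where N: "M = add_mset x N" "f x = y" "image_mset f N = mset ys"
      using msed_map_invR[of f M y "mset ys"] by auto
    then obtain xs where "mset xs = N" "map f xs = ys" using Cons.IH by blast
    then have "mset (x # xs) = M \<and> map f (x # xs) = y # ys" using N by simp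
    then show ?case by (rule exI)
  qed simp
  then show ?thesis using that by blast
qed

lemma has_double_shape_obtain_colouring:
  assumes "has_double_shape n lam P"
  obtains p where "colour_shape {1..2 * n} p (parts lam)" "P = colour_classes {1..2 * n} p (length lam)"
proof -
  let ?V = "{1..2 * n}"
  have part: "partition_on ?V P" and cards: "image_mset card (mset_set P) = mset (map (\<lambda>m. 2 * m) lam)"
    using assms by (auto simp: has_double_shape_def)
  have finP: "finite P" using finite_elements[OF _ part] by simp
  obtain Bs where Bs: "mset Bs = mset_set P" "map card Bs = map (\<lambda>m. 2 * m) lam"
    using image_mset_eq_mset_obtain_list[OF cards] .
  have setBs: "set Bs = P" using Bs(1) finP by (metis finite_set_mset_mset_set set_mset_mset)
  have distBs: "distinct Bs"
    using Bs(1) finP by (metis distinct_count_atmost_1 count_mset_set(1,3) setBs set_mset_mset)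
  have len: "length Bs = length lam" using Bs(2) by (metis length_map)
  have ex1: "\<exists>!i. i < length Bs \<and> v \<in> Bs ! i" if v: "v \<in> ?V" for v
  proof -
    obtain B where "B \<in> P" "v \<in> B" using part v unfolding partition_on_def by blast
    then obtain i where i: "i < length Bs" "v \<in> Bs ! i" using setBs by (metis in_set_conv_nth)
    have "j = i" if j: "j < length Bs" "v \<in> Bs ! j" for j
    proof -
      have "Bs ! i \<in> P" "Bs ! j \<in> P" using i j setBs by auto
      then have "Bs ! i = Bs ! j" using i j part by (auto simp: partition_on_def disjoint_def)
      then show ?thesis using distBs i j nth_eq_iff_index_eq by blast
    qed
    then show ?thesis using i by blast
  qed
  \<comment> \<open>The position of the block containing \<open>v\<close>, unique because the blocks
    are disjoint and \<open>Bs\<close> has no repetitions.\<close>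
  define p where "p v = (THE i. i < length Bs \<and> v \<in> Bs ! i)" for v
  have p: "p v = i \<longleftrightarrow> i < length Bs \<and> v \<in> Bs ! i" if v: "v \<in> ?V" for v i
    using theI'[OF ex1[OF v]] ex1[OF v] unfolding p_def by blast
  have sub: "Bs ! i \<subseteq> ?V" if "i < length Bs" for i
    using that setBs part nth_mem by (fastforce simp: partition_on_def)
  have classes: "{v\<in>?V. p v = i} = (if i < length Bs then Bs ! i else {})" for i
    using p sub by (cases "i < length Bs") (auto simp del: One_nat_def atLeastAtMost_iff)
  have "colour_shape ?V p (parts lam)"
    unfolding colour_shape_def
  proof
    fix i
    show "card {v\<in>?V. p v = i} = 2 * parts lam i"
    proof (cases "i < length lam")
      case True
      then have "map card Bs ! i = 2 * lam ! i" using Bs(2) by simp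
      then show ?thesis using True len unfolding classes by (simp add: parts_def)
    next
      case False
      then show ?thesis using len unfolding classes by (simp add: parts_def)
    qed
  qed
  moreover have "P = colour_classes ?V p (length lam)"
    unfolding colour_classes_def classes using setBs len by (auto simp: set_conv_nth)
  ultimately show ?thesis using that by blast
qed

lemma refines_colour_classes_iff:
  assumes "matching_on V M" "partition_on V (colour_classes V p L)"
  shows "refines V M (colour_classes V p L) \<longleftrightarrow> monochromatic p M"
proof
  assume ref: "refines V M (colour_classes V p L)"
  show "monochromatic p M"
    unfolding monochromatic_def
  proof (intro ballI)
    fix e x y assume e: "e \<in> M" "x \<in> e" "y \<in> e"
    obtain Y where "Y \<in> colour_classes V p L" "e \<subseteq> Y"
      using ref e(1) unfolding refines_def by blast
    then obtain i where "e \<subseteq> {v\<in>V. p v = i}" by (auto simp: colour_classes_def)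
    then show "p x = p y" using e by auto
  qed
next
  assume mono: "monochromatic p M"
  have M: "partition_on V M" using assms(1) by (simp add: matching_on_def)
  have "\<exists>Y\<in>colour_classes V p L. e \<subseteq> Y" if e: "e \<in> M" for e
  proof -
    obtain x where x: "x \<in> e" using M e by (metis equals0I partition_onD3)
    have "e \<subseteq> V" using M e by (auto simp: partition_on_def)
    then obtain Y where Y: "Y \<in> colour_classes V p L" "x \<in> Y"
      using assms(2) x by (auto simp: partition_on_def)
    then have "Y = {v\<in>V. p v = p x}" by (auto simp: colour_classes_def)
    then have "e \<subseteq> Y" using mono e x \<open>e \<subseteq> V\<close> unfolding monochromatic_def by blast
    then show ?thesis using Y by blast
  qed
  then show "refines V M (colour_classes V p L)" using M assms(2) by (simp add: refines_def)
qed

text \<open>Several colourings may induce the same set partition, by permuting equal parts, but each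
  colouring of the shape induces one and each set partition arises, so the universal quantifiers are
  equivalent.\<close>

lemma factorisation_iff_colourings:
  assumes "\<forall>m\<in>set lam. 0 < m"
  shows "factorisation n lam D c \<longleftrightarrow>
    D \<noteq> {} \<and> (\<forall>M\<in>D. matching_on {1..2 * n} M) \<and>
    (\<forall>p. colour_shape {1..2 * n} p (parts lam) \<longrightarrow> card (D \<inter> mono_matchings {1..2 * n} p) = c)"
proof -
  let ?V = "{1..2 * n}"
  have pm: "perfect_matching n M \<longleftrightarrow> matching_on ?V M" for M
    by (simp add: perfect_matching_def matching_on_def)
  have eq: "{M\<in>D. refines ?V M (colour_classes ?V p (length lam))} = D \<inter> mono_matchings ?V p"
    if "colour_shape ?V p (parts lam)" "\<forall>M\<in>D. matching_on ?V M" for p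
  proof -
    have "partition_on ?V (colour_classes ?V p (length lam))"
      by (rule partition_on_colour_classes[OF _ assms that(1)]) simp
    then show ?thesis
      using that(2) refines_colour_classes_iff[of ?V _ p "length lam"]
      unfolding mono_matchings_def by blast
  qed
  have "(\<forall>P. has_double_shape n lam P \<longrightarrow> card {M\<in>D. refines ?V M P} = c) \<longleftrightarrow>
      (\<forall>p. colour_shape ?V p (parts lam) \<longrightarrow> card (D \<inter> mono_matchings ?V p) = c)"
    if D: "\<forall>M\<in>D. matching_on ?V M"
  proof (intro iffI allI impI)
    fix p assume "\<forall>P. has_double_shape n lam P \<longrightarrow> card {M\<in>D. refines ?V M P} = c"
      and p: "colour_shape ?V p (parts lam)"
    then have "card {M\<in>D. refines ?V M (colour_classes ?V p (length lam))} = c"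
      using has_double_shape_colour_classes[OF assms p] by blast
    then show "card (D \<inter> mono_matchings ?V p) = c" unfolding eq[OF p D] .
  next
    fix P assume *: "\<forall>p. colour_shape ?V p (parts lam) \<longrightarrow> card (D \<inter> mono_matchings ?V p) = c"
      and "has_double_shape n lam P"
    then obtain p where p: "colour_shape ?V p (parts lam)" "P = colour_classes ?V p (length lam)"
      using has_double_shape_obtain_colouring by blast
    show "card {M\<in>D. refines ?V M P} = c" unfolding p(2) eq[OF p(1) D] using * p(1) by blast
  qed
  then show ?thesis unfolding factorisation_def pm by blast
qed

section \<open>Comparison of the indices for the two partitions\<close>

lemma double_fact_pos: "0 < double_fact k"
  by (induction k rule: double_fact.induct) auto

lemma double_fact_prod_pos: "0 < double_fact_prod lam"
  by (induction lam) (auto simp: double_fact_prod_def double_fact_pos)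

theorem mainTheorem4:
  fixes n :: nat and lam mu :: "nat list" and D :: "nat set set set" and c_lam :: nat
  assumes "n \<ge> 1"
    and "number_partition n lam"
    and "number_partition n mu"
    and "dominated_by lam mu"
    and "factorisation n lam D c_lam"
  shows "(\<exists>c_mu. factorisation n mu D c_mu \<and>
            (of_nat c_mu :: rat) =
              of_nat c_lam * (of_nat (double_fact_prod mu) / of_nat (double_fact_prod lam))) \<and>
         double_fact_prod lam dvd c_lam * double_fact_prod mu"
proof -
  let ?V = "{1..2 * n}"
  let ?mono = "\<lambda>p. mono_matchings ?V p"
  have pos: "\<forall>m\<in>set lam. 0 < m" "\<forall>m\<in>set mu. 0 < m"
    and sums: "sum_list lam = n" "sum_list mu = n"
    using assms(2,3) by (auto simp: number_partition_def)
  note D = assms(5)[unfolded factorisation_iff_colourings[OF pos(1)]]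
  \<comment> \<open>On colourings of shape \<open>lam\<close> a proportion
    \<open>c_lam / double_fact_prod lam\<close> of the monochromatic matchings lies in
    \<open>D\<close>; subtracting it from the indicator and clearing the denominator gives an
    integer weight.\<close>
  define f :: "nat set set \<Rightarrow> int" where
    "f M = int (double_fact_prod lam) * (if M \<in> D then 1 else 0) - int c_lam" for M
  have sum_f: "sum f (?mono p) =
      int (double_fact_prod lam * card (D \<inter> ?mono p)) - int (c_lam * card (?mono p))" for p
  proof -
    have "(\<Sum>M\<in>?mono p. if M \<in> D then 1 else 0 :: int) = int (card (D \<inter> ?mono p))"
      by (simp add: sum.If_cases finite_mono_matchings Int_commute)
    then show ?thesis by (simp add: f_def sum_subtractf flip: sum_distrib_left)
  qed
  have zero: "sum f (?mono p) = 0" if "colour_shape ?V p (parts lam)" for p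
    using D that by (simp add: sum_f card_mono_matchings_parts del: One_nat_def)
  \<comment> \<open>Free of denominators, this yields both the index formula and the
    divisibility.\<close>
  have key: "double_fact_prod lam * card (D \<inter> ?mono p) = c_lam * double_fact_prod mu"
    if p: "colour_shape ?V p (parts mu)" for p
  proof -
    have "sum f (?mono p) = 0"
    proof (rule sum_mono_matchings_zero_dominance[OF _ antimono_parts[OF assms(2)] antimono_parts[OF assms(3)]])
      show "(\<Sum>l<k. parts lam l) \<le> (\<Sum>l<k. parts mu l)" for k
        using assms(4) by (simp add: sum_parts dominated_by_def)
      \<comment> \<open>Beyond both lengths each partial sum equals \<open>n\<close>.\<close>
      show "(\<Sum>l<k. parts lam l) = (\<Sum>l<k. parts mu l)" if "k \<ge> max (length lam) (length mu)" for k
        using that sums by (simp add: sum_parts)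
    qed (use zero p in auto)
    then show ?thesis
      using p unfolding sum_f card_mono_matchings_parts[OF finite_atLeastAtMost p] by linarith
  qed
  \<comment> \<open>The index for \<open>mu\<close> is read off from one colouring; cancelling the
    positive factor in \<open>key\<close> shows that all others give the same count.\<close>
  obtain p0 where p0: "colour_shape ?V p0 (parts mu)"
    using ex_colour_shape_parts[of ?V mu] sums by auto
  let ?c = "card (D \<inter> ?mono p0)"
  have "card (D \<inter> ?mono p) = ?c" if "colour_shape ?V p (parts mu)" for p
    using key[OF that] key[OF p0] double_fact_prod_pos[of lam] by (metis mult_left_cancel less_irrefl)
  then have "factorisation n mu D ?c"
    unfolding factorisation_iff_colourings[OF pos(2)] using D by blast
  moreover have "(of_nat ?c :: rat) =
      of_nat c_lam * (of_nat (double_fact_prod mu) / of_nat (double_fact_prod lam))"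
  proof -
    have "(of_nat (double_fact_prod lam) * of_nat ?c :: rat) = of_nat c_lam * of_nat (double_fact_prod mu)"
      using key[OF p0] by (metis of_nat_mult)
    then show ?thesis using double_fact_prod_pos[of lam] by (simp add: field_simps)
  qed
  moreover have "double_fact_prod lam dvd c_lam * double_fact_prod mu"
    using key[OF p0] by (metis dvd_triv_left)
  ultimately show ?thesis by blast
qed

end
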